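(* If a graph $G$ is strongly EFX-orientable, then $\chi(G)\le 3$.
   Context: All graphs are finite and simple. For a graph $G=(V,E)$ and $v\in V$, $E(v)$ is the set of edges incident to $v$. A graphical instance on $G$ assigns to each vertex $v$ a valuation $f_v:2^E\to\mathbb{R}_{\ge 0}$ that is monotone ($A\subseteq B\Rightarrow f_v(A)\le f_v(B)$) and satisfies $f_v(X)=f_v(X\cap E(v))$ for all $X\subseteq E$. An orientation of $G$ chooses for each edge one of its endpoints as its head; vertex $v$ receives the bundle $X_v$ of edges whose head is $v$. The orientation is EFX if for all $u,v\in V$ and every $g\in X_v$, $f_u(X_u)\ge f_u(X_v\setminus\{g\})$. A graph $G$ is strongly EFX-orientable if for every graphical instance on $G$ there exists an EFX orientation. *)

theory Defs
  imports Complex_Main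
begin

definition simple_graph :: "'v set \<Rightarrow> 'v set set \<Rightarrow> bool" where
  "simple_graph V E \<longleftrightarrow> finite V \<and> (\<forall>e\<in>E. e \<subseteq> V \<and> card e = 2)"

definition incident :: "'v set set \<Rightarrow> 'v \<Rightarrow> 'v set set" where
  "incident E v = {e \<in> E. v \<in> e}"

definition graphical_instance ::
  "'v set \<Rightarrow> 'v set set \<Rightarrow> ('v \<Rightarrow> 'v set set \<Rightarrow> real) \<Rightarrow> bool" where
  "graphical_instance V E f \<longleftrightarrow>
     (\<forall>v\<in>V. (\<forall>X. X \<subseteq> E \<longrightarrow> f v X \<ge> 0)
          \<and> (\<forall>A B. A \<subseteq> B \<and> B \<subseteq> E \<longrightarrow> f v A \<le> f v B)
          \<and> (\<forall>X. X \<subseteq> E \<longrightarrow> f v X = f v (X \<inter> incident E v)))"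

definition orientation :: "'v set set \<Rightarrow> ('v set \<Rightarrow> 'v) \<Rightarrow> bool" where
  "orientation E h \<longleftrightarrow> (\<forall>e\<in>E. h e \<in> e)"

definition bndl :: "'v set set \<Rightarrow> ('v set \<Rightarrow> 'v) \<Rightarrow> 'v \<Rightarrow> 'v set set" where
  "bndl E h v = {e \<in> E. h e = v}"

definition EFX_orientation ::
  "'v set \<Rightarrow> 'v set set \<Rightarrow> ('v \<Rightarrow> 'v set set \<Rightarrow> real) \<Rightarrow> ('v set \<Rightarrow> 'v) \<Rightarrow> bool" where
  "EFX_orientation V E f h \<longleftrightarrow> orientation E h \<and>
     (\<forall>u\<in>V. \<forall>v\<in>V. \<forall>g\<in>bndl E h v. f u (bndl E h u) \<ge> f u (bndl E h v - {g}))"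

definition strongly_EFX_orientable :: "'v set \<Rightarrow> 'v set set \<Rightarrow> bool" where
  "strongly_EFX_orientable V E \<longleftrightarrow>
     (\<forall>f. graphical_instance V E f \<longrightarrow> (\<exists>h. EFX_orientation V E f h))"

definition colorable :: "'v set \<Rightarrow> 'v set set \<Rightarrow> nat \<Rightarrow> bool" where
  "colorable V E k \<longleftrightarrow> (\<exists>c::'v \<Rightarrow> nat. (\<forall>v\<in>V. c v < k) \<and>
      (\<forall>e\<in>E. \<forall>u\<in>e. \<forall>w\<in>e. u \<noteq> w \<longrightarrow> c u \<noteq> c w))"

definition chromatic_number :: "'v set \<Rightarrow> 'v set set \<Rightarrow> nat" where
  "chromatic_number V E = (LEAST k. colorable V E k)"

end

theory Submission
  imports Defs "HOL-Combinatorics.Transposition"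
begin

text \<open>
  We add the edges one at a time. If a 3-coloring \<open>c\<close> of a subgraph does not extend to a new edge
  \<open>xy\<close>, then \<open>c x = c y\<close>, and Kempe chains in both other colors connect \<open>x\<close> and \<open>y\<close>. In each chain,
  breadth-first search (from \<open>x\<close> in the first color, from \<open>y\<close> in the second) assigns to every vertex
  \<open>b\<close> of the other color a neighbor \<open>r b\<close> of color \<open>c x\<close>. Let every vertex value a bundle by its
  heaviest incident edge, where the edges between \<open>r b\<close> and \<open>b\<close> have weight 2, \<open>xy\<close> has weight 1 and
  all other edges have weight 0. In an EFX orientation, a vertex of color \<open>c x\<close> that receives an
  edge of weight below 2 receives none of weight 2; so each \<open>b\<close> with root \<open>r b\<close> at that vertex is
  given the edge from \<open>r b\<close>, hence no other one, and its remaining neighbors receive light edges too.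
  The end of \<open>xy\<close> that receives \<open>xy\<close> thus forces light edges from the chains on both \<open>x\<close> and \<open>y\<close>,
  and the other end envies it.
\<close>

section \<open>Valuations by the heaviest edge\<close>

definition max_weight :: "'v set set \<Rightarrow> ('v set \<Rightarrow> real) \<Rightarrow> 'v \<Rightarrow> 'v set set \<Rightarrow> real" where
  "max_weight E w v X = Max (insert 0 (w ` (X \<inter> incident E v)))"

lemma finite_incident: "finite E \<Longrightarrow> finite (incident E v)"
  by (simp add: incident_def)

lemma simple_graph_finite_edges: "simple_graph V E \<Longrightarrow> finite E"
  unfolding simple_graph_def by (meson PowI finite_Pow_iff finite_subset subsetI)

lemma max_weight_ge_iff:
  assumes "finite E" "0 < t"
  shows "t \<le> max_weight E w v X \<longleftrightarrow> (\<exists>e\<in>X \<inter> incident E v. t \<le> w e)"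
  unfolding max_weight_def using assms finite_incident[of E v] by (subst Max_ge_iff) auto

lemma graphical_instance_max_weight:
  assumes "finite E"
  shows "graphical_instance V E (max_weight E w)"
proof -
  have finite_weights: "finite (insert 0 (w ` (X \<inter> incident E v)))" for v X
    using finite_incident[OF assms] by simp
  have "max_weight E w v A \<le> max_weight E w v B" if "A \<subseteq> B" for v A B
    unfolding max_weight_def using that finite_weights by (intro Max_mono) auto
  moreover have "0 \<le> max_weight E w v X" for v X
    unfolding max_weight_def using finite_weights by (intro Max_ge) auto
  moreover have "max_weight E w v X = max_weight E w v (X \<inter> incident E v)" for v X
    by (simp add: max_weight_def Int_assoc)
  ultimately show ?thesis
    by (simp add: graphical_instance_def)
qed

lemma EFX_orientation_max_weightE:
  assumes graph: "simple_graph V E" and efx: "EFX_orientation V E (max_weight E w) h"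
    and received: "e \<in> bndl E h v" "u \<in> e" "0 < w e" and other: "bndl E h v \<noteq> {e}"
  obtains e' where "e' \<in> bndl E h u" "u \<in> e'" "w e \<le> w e'"
proof -
  have finite_E: "finite E"
    using graph by (rule simple_graph_finite_edges)
  obtain g where removed: "g \<in> bndl E h v" "g \<noteq> e"
    using received(1) other by blast
  have "e \<in> E" "v \<in> e"
    using received(1) efx by (auto simp: bndl_def EFX_orientation_def orientation_def)
  then have "u \<in> V" "v \<in> V"
    using graph received(2) by (auto simp: simple_graph_def)
  have "w e \<le> max_weight E w u (bndl E h v - {g})"
    using max_weight_ge_iff[OF finite_E received(3)] received removed(2) \<open>e \<in> E\<close>
    by (auto simp: incident_def)
  also have "\<dots> \<le> max_weight E w u (bndl E h u)"
    using efx removed(1) \<open>u \<in> V\<close> \<open>v \<in> V\<close> by (simp add: EFX_orientation_def)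
  finally show thesis
    using max_weight_ge_iff[OF finite_E received(3)] that by (auto simp: incident_def)
qed

section \<open>Heavy stars in EFX orientations\<close>

text \<open>A star forest is given by its set \<open>B\<close> of leaves and the map \<open>r\<close> from leaves to centers.\<close>

definition star_edges :: "'v set \<Rightarrow> ('v \<Rightarrow> 'v) \<Rightarrow> 'v set set" where
  "star_edges B r = (\<lambda>b. {r b, b}) ` B"

definition star_step :: "'v set set \<Rightarrow> 'v set \<Rightarrow> ('v \<Rightarrow> 'v) \<Rightarrow> ('v \<times> 'v) set" where
  "star_step E B r = {(r b, v) | b v. b \<in> B \<and> {b, v} \<in> E \<and> v \<noteq> r b}"

definition star_weight :: "'v set \<Rightarrow> ('v \<Rightarrow> 'v) \<Rightarrow> 'v set \<Rightarrow> 'v set \<Rightarrow> real" where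
  "star_weight B r d e = (if e \<in> star_edges B r then 2 else if e = d then 1 else 0)"

lemma star_step_mono: "F \<subseteq> E \<Longrightarrow> star_step F B r \<subseteq> star_step E B r"
  by (auto simp: star_step_def)

locale EFX_star_orientation =
  fixes V :: "'v set" and E :: "'v set set" and B :: "'v set" and r :: "'v \<Rightarrow> 'v"
    and d :: "'v set" and h :: "'v set \<Rightarrow> 'v"
  assumes graph: "simple_graph V E"
    and star_edges_subset: "star_edges B r \<subseteq> E"
    and roots_not_leaves: "r ` B \<inter> B = {}"
    and efx: "EFX_orientation V E (max_weight E (star_weight B r d)) h"
begin

lemma root_not_leaf: "b \<in> B \<Longrightarrow> r b \<notin> B"
  using roots_not_leaves by blast

definition light_receiver :: "'v \<Rightarrow> bool" where
  "light_receiver v \<longleftrightarrow> \<not> bndl E h v \<subseteq> star_edges B r"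

lemma head_mem: "e \<in> E \<Longrightarrow> h e \<in> e"
  using efx by (simp add: EFX_orientation_def orientation_def)

lemma star_edge_at_leaf: "e \<in> star_edges B r \<Longrightarrow> b \<in> B \<Longrightarrow> b \<in> e \<Longrightarrow> e = {r b, b}"
  using root_not_leaf by (auto simp: star_edges_def)

lemma star_edge_envied:
  assumes "e \<in> star_edges B r" "e \<in> bndl E h v" "u \<in> e" "bndl E h v \<noteq> {e}"
  obtains e' where "e' \<in> star_edges B r" "e' \<in> bndl E h u" "u \<in> e'"
proof -
  obtain e' where "e' \<in> bndl E h u" "u \<in> e'" "star_weight B r d e \<le> star_weight B r d e'"
    using EFX_orientation_max_weightE[OF graph efx assms(2,3) _ assms(4)] assms(1)
    by (auto simp: star_weight_def)
  then show thesis
    using that assms(1) by (auto simp: star_weight_def split: if_splits)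
qed

lemma light_receiver_no_star_edge:
  assumes "light_receiver u" "u \<notin> B"
  shows "bndl E h u \<inter> star_edges B r = {}"
proof (rule ccontr)
  assume "bndl E h u \<inter> star_edges B r \<noteq> {}"
  then obtain b where leaf: "b \<in> B" "{r b, b} \<in> star_edges B r" "{r b, b} \<in> bndl E h u"
    by (auto simp: star_edges_def)
  have "bndl E h u \<noteq> {{r b, b}}"
    using assms(1) leaf(2) by (auto simp: light_receiver_def)
  then obtain e where envied: "e \<in> star_edges B r" "e \<in> bndl E h b" "b \<in> e"
    using star_edge_envied[OF leaf(2,3)] by blast
  have "e = {r b, b}"
    using envied(1) leaf(1) envied(3) by (rule star_edge_at_leaf)
  then have "u = b"
    using envied(2) leaf(3) by (simp add: bndl_def)
  then show False
    using leaf(1) assms(2) by simp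
qed

lemma light_receiver_star_step:
  assumes "light_receiver u" "(u, v) \<in> star_step E B r"
  shows "light_receiver v" and "\<exists>b\<in>B. {b, v} \<in> bndl E h v"
proof -
  obtain b where leaf: "b \<in> B" "u = r b" "{b, v} \<in> E" "v \<noteq> r b"
    using assms(2) by (auto simp: star_step_def)
  have light: "{b, v} \<notin> star_edges B r"
    using star_edge_at_leaf[of "{b, v}" b] leaf root_not_leaf[of b]
    by (auto simp: doubleton_eq_iff)
  have heavy: "{r b, b} \<in> star_edges B r"
    using leaf(1) by (simp add: star_edges_def)
  have no_heavy: "bndl E h u \<inter> star_edges B r = {}"
    using light_receiver_no_star_edge assms(1) leaf root_not_leaf by blast
  have "{r b, b} \<in> E"
    using heavy star_edges_subset by blast
  moreover have "h {r b, b} \<noteq> r b"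
    using no_heavy heavy \<open>{r b, b} \<in> E\<close> leaf(2) by (auto simp: bndl_def)
  ultimately have heavy_received: "{r b, b} \<in> bndl E h b"
    using head_mem[of "{r b, b}"] by (auto simp: bndl_def)
  have "bndl E h b = {{r b, b}}"
  proof (rule ccontr)
    assume "bndl E h b \<noteq> {{r b, b}}"
    then obtain e where "e \<in> star_edges B r" "e \<in> bndl E h u"
      using star_edge_envied[OF heavy heavy_received, of u] leaf(2) by auto
    then show False
      using no_heavy by blast
  qed
  then have "{b, v} \<notin> bndl E h b"
    using light heavy by auto
  then have received: "{b, v} \<in> bndl E h v"
    using head_mem[OF leaf(3)] leaf(3) by (auto simp: bndl_def)
  then show "light_receiver v" "\<exists>b\<in>B. {b, v} \<in> bndl E h v"
    using light leaf(1) by (auto simp: light_receiver_def)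
qed

lemma light_receiver_star_trancl:
  assumes "light_receiver u" "(u, v) \<in> (star_step E B r)\<^sup>+"
  shows "light_receiver v" and "\<exists>b\<in>B. {b, v} \<in> bndl E h v"
proof -
  have "light_receiver v \<and> (\<exists>b\<in>B. {b, v} \<in> bndl E h v)"
    using assms(2)
  proof (induction rule: trancl_induct)
    case (base v)
    then show ?case
      using light_receiver_star_step[OF assms(1)] by simp
  next
    case (step v w)
    then show ?case
      using light_receiver_star_step[of v w] by simp
  qed
  then show "light_receiver v" "\<exists>b\<in>B. {b, v} \<in> bndl E h v"
    by auto
qed

lemma chord_head_neq:
  assumes chord: "d = {u, v}" "d \<in> E" "u \<noteq> v" "u \<notin> B" "v \<notin> B"
    and closed_walk: "(u, v) \<in> (star_step E B r)\<^sup>+" "(v, u) \<in> (star_step E B r)\<^sup>+"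
  shows "h d \<noteq> v"
proof
  assume "h d = v"
  then have received: "d \<in> bndl E h v"
    using chord(2) by (simp add: bndl_def)
  have light: "d \<notin> star_edges B r"
    using chord(1,4,5) by (auto simp: star_edges_def doubleton_eq_iff)
  have "light_receiver v"
    using received light by (auto simp: light_receiver_def)
  then have "light_receiver u"
    using light_receiver_star_trancl(1) closed_walk(2) by blast
  obtain b where "b \<in> B" "{b, v} \<in> bndl E h v"
    using light_receiver_star_trancl(2)[OF \<open>light_receiver u\<close> closed_walk(1)] by blast
  then have "bndl E h v \<noteq> {d}"
    using chord by (auto simp: doubleton_eq_iff)
  moreover have "star_weight B r d d = 1"
    using light by (simp add: star_weight_def)
  moreover have "u \<in> d"
    using chord(1) by simp
  ultimately obtain e where envied: "e \<in> bndl E h u" "1 \<le> star_weight B r d e"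
    using EFX_orientation_max_weightE[OF graph efx received, of u] by auto
  have "e \<notin> star_edges B r"
    using light_receiver_no_star_edge \<open>light_receiver u\<close> chord(4) envied(1) by blast
  then have "e = d"
    using envied(2) by (auto simp: star_weight_def split: if_splits)
  then show False
    using envied(1) \<open>h d = v\<close> chord(3) by (simp add: bndl_def)
qed

end

lemma strongly_EFX_orientable_no_chord:
  assumes graph: "simple_graph V E" and orientable: "strongly_EFX_orientable V E"
    and stars: "star_edges B r \<subseteq> E" "r ` B \<inter> B = {}"
    and ends: "x \<noteq> y" "x \<notin> B" "y \<notin> B"
    and closed_walk: "(x, y) \<in> (star_step E B r)\<^sup>*" "(y, x) \<in> (star_step E B r)\<^sup>*"
  shows "{x, y} \<notin> E"
proof
  assume chord: "{x, y} \<in> E"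
  obtain h where efx: "EFX_orientation V E (max_weight E (star_weight B r {x, y})) h"
    using orientable graphical_instance_max_weight[OF simple_graph_finite_edges[OF graph]]
    unfolding strongly_EFX_orientable_def by blast
  interpret EFX_star_orientation V E B r "{x, y}" h
    using graph stars efx by unfold_locales
  have "(x, y) \<in> (star_step E B r)\<^sup>+" "(y, x) \<in> (star_step E B r)\<^sup>+"
    using closed_walk ends(1) by (auto dest: rtranclD)
  then have "h {x, y} \<noteq> x" "h {x, y} \<noteq> y"
    using chord_head_neq[of x y] chord_head_neq[of y x] chord ends by (auto simp: insert_commute)
  then show False
    using head_mem[OF chord] by blast
qed

section \<open>Kempe chains\<close>

definition proper_coloring :: "'v set \<Rightarrow> 'v set set \<Rightarrow> 'c set \<Rightarrow> ('v \<Rightarrow> 'c) \<Rightarrow> bool" where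
  "proper_coloring V E C c \<longleftrightarrow> c ` V \<subseteq> C \<and> (\<forall>u v. {u, v} \<in> E \<longrightarrow> c u \<noteq> c v)"

definition kempe_edges :: "'v set set \<Rightarrow> ('v \<Rightarrow> 'c) \<Rightarrow> 'c \<Rightarrow> 'c \<Rightarrow> ('v \<times> 'v) set" where
  "kempe_edges E c p q = {(u, v). {u, v} \<in> E \<and> c u = p \<and> c v = q}"

definition kempe_step :: "'v set set \<Rightarrow> ('v \<Rightarrow> 'c) \<Rightarrow> 'c \<Rightarrow> 'c \<Rightarrow> ('v \<times> 'v) set" where
  "kempe_step E c p q = kempe_edges E c p q O (kempe_edges E c p q)\<inverse>"

lemma proper_coloring_insert:
  "proper_coloring V (insert {x, y} E) C c \<longleftrightarrow> proper_coloring V E C c \<and> c x \<noteq> c y"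
  by (auto simp: proper_coloring_def doubleton_eq_iff)

lemma proper_coloring_kempe_swap:
  assumes coloring: "proper_coloring V E C c" and colors: "p \<in> C" "q \<in> C"
    and closed: "\<And>u v. {u, v} \<in> E \<Longrightarrow> u \<in> D \<Longrightarrow> {c u, c v} = {p, q} \<Longrightarrow> v \<in> D"
  shows "proper_coloring V E C (\<lambda>v. if v \<in> D then transpose p q (c v) else c v)"
proof -
  have across: "transpose p q (c u) \<noteq> c v" if "{u, v} \<in> E" "u \<in> D" "v \<notin> D" for u v
    using closed[OF that(1,2)] coloring that by (auto simp: proper_coloring_def transpose_def)
  have "(if u \<in> D then transpose p q (c u) else c u) \<noteq> (if v \<in> D then transpose p q (c v) else c v)"
    if "{u, v} \<in> E" for u v
    using across[of u v] across[of v u] coloring that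
    by (auto simp: proper_coloring_def insert_commute dest: transpose_eq_imp_eq)
  then show ?thesis
    using coloring colors by (auto simp: proper_coloring_def transpose_def)
qed

definition kempe_component :: "'v set set \<Rightarrow> ('v \<Rightarrow> 'c) \<Rightarrow> 'c \<Rightarrow> 'c \<Rightarrow> 'v \<Rightarrow> 'v set" where
  "kempe_component E c p q x =
     (kempe_step E c p q)\<^sup>* `` {x} \<union> ((kempe_step E c p q)\<^sup>* O kempe_edges E c p q) `` {x}"

lemma kempe_step_rtrancl_color: "(x, y) \<in> (kempe_step E c p q)\<^sup>* \<Longrightarrow> c x = p \<Longrightarrow> c y = p"
  by (auto elim!: rtranclE simp: kempe_step_def kempe_edges_def)

lemma mem_kempe_component_iff:
  assumes "c y = p" "p \<noteq> q"
  shows "y \<in> kempe_component E c p q x \<longleftrightarrow> (x, y) \<in> (kempe_step E c p q)\<^sup>*"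
  using assms by (auto simp: kempe_component_def kempe_edges_def)

lemma kempe_component_closed:
  assumes start: "c x = p" and "p \<noteq> q"
    and edge: "{u, v} \<in> E" "{c u, c v} = {p, q}" and member: "u \<in> kempe_component E c p q x"
  shows "v \<in> kempe_component E c p q x"
proof -
  consider (start_color) "(x, u) \<in> (kempe_step E c p q)\<^sup>*"
    | (other_color) t where "(x, t) \<in> (kempe_step E c p q)\<^sup>*" "(t, u) \<in> kempe_edges E c p q"
    using member by (auto simp: kempe_component_def)
  then show ?thesis
  proof cases
    case start_color
    then have "(u, v) \<in> kempe_edges E c p q"
      using kempe_step_rtrancl_color[OF start_color start] edge \<open>p \<noteq> q\<close>
      by (auto simp: kempe_edges_def doubleton_eq_iff)
    then show ?thesis
      using start_color by (auto simp: kempe_component_def)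
  next
    case other_color
    then have "(v, u) \<in> kempe_edges E c p q"
      using edge \<open>p \<noteq> q\<close> by (auto simp: kempe_edges_def doubleton_eq_iff insert_commute)
    then have "(t, v) \<in> kempe_step E c p q"
      using other_color(2) by (auto simp: kempe_step_def)
    then show ?thesis
      using other_color(1) by (auto simp: kempe_component_def intro: rtrancl_into_rtrancl)
  qed
qed

lemma kempe_chain_if_not_extendable:
  assumes coloring: "proper_coloring V E C c" and "q \<in> C" "q \<noteq> c x"
    and "x \<in> V" and same: "c x = c y"
    and not_extendable: "\<nexists>c'. proper_coloring V (insert {x, y} E) C c'"
  shows "(x, y) \<in> (kempe_step E c (c x) q)\<^sup>*"
proof (rule ccontr)
  let ?D = "kempe_component E c (c x) q x"
  assume "(x, y) \<notin> (kempe_step E c (c x) q)\<^sup>*"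
  then have separated: "x \<in> ?D" "y \<notin> ?D"
    using mem_kempe_component_iff same \<open>q \<noteq> c x\<close> by (metis rtrancl.rtrancl_refl)+
  have closed: "v \<in> ?D" if "{u, v} \<in> E" "u \<in> ?D" "{c u, c v} = {c x, q}" for u v
    using \<open>q \<noteq> c x\<close> by (intro kempe_component_closed[OF refl _ that(1,3,2)]) simp
  have "c x \<in> C"
    using coloring \<open>x \<in> V\<close> by (auto simp: proper_coloring_def)
  then have "proper_coloring V E C (\<lambda>v. if v \<in> ?D then transpose (c x) q (c v) else c v)"
    using \<open>q \<in> C\<close> closed by (rule proper_coloring_kempe_swap[OF coloring])
  then have
    "proper_coloring V (insert {x, y} E) C (\<lambda>v. if v \<in> ?D then transpose (c x) q (c v) else c v)"
    using separated same \<open>q \<noteq> c x\<close> by (simp add: proper_coloring_insert)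
  then show False
    using not_extendable by blast
qed

definition root_step :: "('a \<times> 'b) set \<Rightarrow> ('b \<Rightarrow> 'a) \<Rightarrow> ('a \<times> 'a) set" where
  "root_step Q r = {(r b, v) | b v. (v, b) \<in> Q \<and> v \<noteq> r b}"

lemma exists_root_map:
  fixes Q :: "('a \<times> 'b) set"
  shows "\<exists>r. (\<forall>b\<in>Range Q. (r b, b) \<in> Q) \<and>
           (\<forall>v. (x, v) \<in> (Q O Q\<inverse>)\<^sup>* \<longrightarrow> (x, v) \<in> (root_step Q r)\<^sup>*)"
proof -
  define dist where "dist v = (LEAST n. (x, v) \<in> (Q O Q\<inverse>) ^^ n)" for v
  define r where "r b = arg_min dist (\<lambda>u. (u, b) \<in> Q)" for b
  have root_mem: "(r b, b) \<in> Q" and dist_root: "dist (r b) \<le> dist u" if "(u, b) \<in> Q" for u b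
    using arg_min_nat_lemma[of "\<lambda>u. (u, b) \<in> Q" u dist] that by (auto simp: r_def)
  have "(x, v) \<in> (root_step Q r)\<^sup>*" if "(x, v) \<in> (Q O Q\<inverse>)\<^sup>*" for v
    using that
  proof (induction "dist v" arbitrary: v rule: less_induct)
    case less
    have dist_v: "(x, v) \<in> (Q O Q\<inverse>) ^^ dist v"
      using less.prems unfolding dist_def rtrancl_power by (rule LeastI_ex)
    show ?case
    proof (cases "dist v")
      case 0
      then show ?thesis
        using dist_v by simp
    next
      case (Suc n)
      then obtain u b where walk_u: "(x, u) \<in> (Q O Q\<inverse>) ^^ n" and edges: "(u, b) \<in> Q" "(v, b) \<in> Q"
        using dist_v by auto
      have "dist (r b) \<le> dist u"
        using dist_root edges(1) by simp
      also have "dist u \<le> n"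
        using walk_u unfolding dist_def by (rule Least_le)
      finally have closer: "dist (r b) < dist v"
        using Suc by simp
      have "(u, r b) \<in> Q O Q\<inverse>"
        using edges(1) root_mem[OF edges(1)] by blast
      then have "(x, r b) \<in> (Q O Q\<inverse>)\<^sup>*"
        using relpow_imp_rtrancl[OF walk_u] by (rule rtrancl_into_rtrancl[rotated])
      then have "(x, r b) \<in> (root_step Q r)\<^sup>*"
        using less.hyps closer by blast
      moreover have "(r b, v) \<in> root_step Q r"
        using edges(2) closer by (auto simp: root_step_def)
      ultimately show ?thesis
        by (rule rtrancl_into_rtrancl)
    qed
  qed
  then show ?thesis
    using root_mem by (intro exI[of _ r]) blast
qed

lemma root_step_kempe_edges_subset:
  assumes agree: "\<And>b. b \<in> Range (kempe_edges E c p q) \<Longrightarrow> b \<in> B \<and> r b = r' b"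
  shows "root_step (kempe_edges E c p q) r' \<subseteq> star_step E B r"
proof clarify
  fix u v
  assume "(u, v) \<in> root_step (kempe_edges E c p q) r'"
  then obtain b where branch: "(v, b) \<in> kempe_edges E c p q" "u = r' b" "v \<noteq> r' b"
    by (auto simp: root_step_def)
  moreover have "b \<in> B \<and> r b = r' b"
    using branch(1) by (intro agree) (rule RangeI)
  moreover have "{b, v} \<in> E"
    using branch(1) by (simp add: kempe_edges_def insert_commute)
  ultimately show "(u, v) \<in> star_step E B r"
    by (auto simp: star_step_def intro!: exI[of _ b])
qed

lemma kempe_chains_imp_stars:
  assumes colors: "p \<noteq> c x" "q \<noteq> c x" "p \<noteq> q" "c y = c x"
    and chains: "(x, y) \<in> (kempe_step E c (c x) p)\<^sup>*" "(y, x) \<in> (kempe_step E c (c x) q)\<^sup>*"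
  obtains B r where "star_edges B r \<subseteq> E" "r ` B \<inter> B = {}" "x \<notin> B" "y \<notin> B"
    "(x, y) \<in> (star_step E B r)\<^sup>*" "(y, x) \<in> (star_step E B r)\<^sup>*"
proof -
  let ?P = "kempe_edges E c (c x) p" and ?Q = "kempe_edges E c (c x) q"
  obtain rp where rp: "\<forall>b\<in>Range ?P. (rp b, b) \<in> ?P" "(x, y) \<in> (root_step ?P rp)\<^sup>*"
    using exists_root_map[of ?P x] chains(1) unfolding kempe_step_def by blast
  obtain rq where rq: "\<forall>b\<in>Range ?Q. (rq b, b) \<in> ?Q" "(y, x) \<in> (root_step ?Q rq)\<^sup>*"
    using exists_root_map[of ?Q y] chains(2) unfolding kempe_step_def by blast
  define B where "B = Range ?P \<union> Range ?Q"
  define r where "r b = (if c b = p then rp b else rq b)" for b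
  have leaf_P: "b \<in> B \<and> r b = rp b" if "b \<in> Range ?P" for b
    using that by (auto simp: B_def r_def kempe_edges_def)
  have leaf_Q: "b \<in> B \<and> r b = rq b" if "b \<in> Range ?Q" for b
    using that colors(3) by (auto simp: B_def r_def kempe_edges_def)
  have star: "{r b, b} \<in> E \<and> c (r b) = c x \<and> c b \<noteq> c x" if "b \<in> B" for b
  proof -
    have "(r b, b) \<in> ?P \<or> (r b, b) \<in> ?Q"
      using that leaf_P[of b] leaf_Q[of b] rp(1) rq(1) unfolding B_def by (metis UnE)
    then show ?thesis
      using colors(1,2) by (auto simp: kempe_edges_def)
  qed
  have "star_edges B r \<subseteq> E"
    using star by (auto simp: star_edges_def)
  moreover have "r b \<notin> B" if "b \<in> B" for b
    using star[OF that] star[of "r b"] by blast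
  then have "r ` B \<inter> B = {}"
    by blast
  moreover have "x \<notin> B" "y \<notin> B"
    using star[of x] star[of y] colors(4) by auto
  moreover have "root_step ?P rp \<subseteq> star_step E B r" "root_step ?Q rq \<subseteq> star_step E B r"
    using leaf_P leaf_Q by (intro root_step_kempe_edges_subset; blast)+
  then have "(x, y) \<in> (star_step E B r)\<^sup>*" "(y, x) \<in> (star_step E B r)\<^sup>*"
    using rp(2) rq(2) rtrancl_mono by blast+
  ultimately show thesis
    by (rule that)
qed

section \<open>Extending a coloring edge by edge\<close>

lemma strongly_EFX_orientable_extend_coloring:
  assumes graph: "simple_graph V E" and orientable: "strongly_EFX_orientable V E"
    and "F \<subseteq> E" "e \<in> E" and "card C = 3" and coloring: "proper_coloring V F C c"
  shows "\<exists>c'. proper_coloring V (insert e F) C c'"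
proof (rule ccontr)
  assume not_extendable: "\<nexists>c'. proper_coloring V (insert e F) C c'"
  have "card e = 2" "e \<subseteq> V"
    using graph \<open>e \<in> E\<close> by (auto simp: simple_graph_def)
  then obtain x y where e_eq: "e = {x, y}" and ends: "x \<noteq> y" "x \<in> V" "y \<in> V"
    by (auto simp: card_2_iff)
  have same: "c x = c y"
    using not_extendable coloring proper_coloring_insert unfolding e_eq by metis
  have "c x \<in> C"
    using coloring ends(2) by (auto simp: proper_coloring_def)
  then have "card (C - {c x}) = 2"
    using \<open>card C = 3\<close> by simp
  then obtain p q where "C - {c x} = {p, q}" and "p \<noteq> q"
    by (meson card_2_iff)
  then have others: "p \<in> C" "q \<in> C" "p \<noteq> c x" "q \<noteq> c x"
    by auto
  have chain_p: "(x, y) \<in> (kempe_step F c (c x) p)\<^sup>*"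
    using kempe_chain_if_not_extendable[OF coloring others(1,3) ends(2) same] not_extendable
    by (simp add: e_eq)
  have chain_q: "(y, x) \<in> (kempe_step F c (c x) q)\<^sup>*"
    unfolding same using others(4) not_extendable
    by (intro kempe_chain_if_not_extendable[OF coloring others(2) _ ends(3) same[symmetric]])
      (simp_all add: e_eq same insert_commute)
  obtain B r where stars: "star_edges B r \<subseteq> F" "r ` B \<inter> B = {}" "x \<notin> B" "y \<notin> B"
    and walk: "(x, y) \<in> (star_step F B r)\<^sup>*" "(y, x) \<in> (star_step F B r)\<^sup>*"
    using kempe_chains_imp_stars[where c = c, OF others(3,4) \<open>p \<noteq> q\<close> same[symmetric] chain_p chain_q]
    by metis
  have "(star_step F B r)\<^sup>* \<subseteq> (star_step E B r)\<^sup>*"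
    using \<open>F \<subseteq> E\<close> by (intro rtrancl_mono star_step_mono)
  then have "{x, y} \<notin> E"
    using strongly_EFX_orientable_no_chord[OF graph orientable, of B r x y] stars walk ends(1) \<open>F \<subseteq> E\<close>
    by blast
  then show False
    using \<open>e \<in> E\<close> e_eq by simp
qed

lemma strongly_EFX_orientable_proper_coloring:
  assumes graph: "simple_graph V E" and orientable: "strongly_EFX_orientable V E"
    and "card C = 3"
  shows "\<exists>c. proper_coloring V E C c"
  using simple_graph_finite_edges[OF graph] subset_refl
proof (induction rule: finite_subset_induct')
  case empty
  obtain a where "a \<in> C"
    using \<open>card C = 3\<close> by fastforce
  then show ?case
    by (intro exI[of _ "\<lambda>_. a"]) (auto simp: proper_coloring_def)
next
  case (insert e F)
  then show ?case
    using strongly_EFX_orientable_extend_coloring[OF graph orientable] \<open>card C = 3\<close> by blast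
qed

lemma proper_coloring_imp_colorable:
  assumes "simple_graph V E" "proper_coloring V E {..<k} c"
  shows "colorable V E k"
proof -
  have "c u \<noteq> c v" if "e \<in> E" "u \<in> e" "v \<in> e" "u \<noteq> v" for e u v
  proof -
    have "e = {u, v}"
      using assms(1) that by (auto simp: simple_graph_def card_2_iff)
    then show ?thesis
      using assms(2) that(1) by (simp add: proper_coloring_def)
  qed
  then show ?thesis
    using assms(2) unfolding colorable_def proper_coloring_def by (intro exI[of _ c]) auto
qed

theorem mainTheorem5:
  fixes V :: "'v set" and E :: "'v set set"
  assumes "simple_graph V E"
    and "strongly_EFX_orientable V E"
  shows "chromatic_number V E \<le> 3"
proof -
  obtain c where "proper_coloring V E {..<3::nat} c"
    using strongly_EFX_orientable_proper_coloring[OF assms, of "{..<3::nat}"] by auto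
  then have "colorable V E 3"
    using proper_coloring_imp_colorable assms(1) by blast
  then show ?thesis
    unfolding chromatic_number_def by (rule Least_le)
qed

end
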